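(* Let $X$ be a real random variable with mean $\mu$ and log-concave density $f:\mathbb{R}\to[0,\infty)$ with respect to Lebesgue measure, and let $t\in\mathbb{R}$. Then $$2\operatorname{Var}(X)\le \frac{1}{f^2(t)}+(\mu-t)^2 .$$
   Context: A function $f:\mathbb{R}\to[0,\infty)$ is log-concave if $f((1-s)x+sy)\ge f(x)^{1-s}f(y)^s$ for all $x,y\in\mathbb{R}$ and $s\in[0,1]$. Here $f^2(t)=(f(t))^2$, and $1/f^2(t)$ is interpreted as $+\infty$ when $f(t)=0$. *)

theory Defs
  imports "HOL-Probability.Probability"
begin

text \<open>
  With \<^term>\<open>(0::real) powr 0 = 0\<close> in place of the convention \<open>0\<^sup>0 = 1\<close>, only the cases
  \<open>s = 0\<close> and \<open>s = 1\<close> are affected, and for nonnegative \<open>f\<close> they hold trivially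
  under either convention.
\<close>

definition log_concave :: "(real \<Rightarrow> real) \<Rightarrow> bool" where
  "log_concave f \<longleftrightarrow>
     (\<forall>x. 0 \<le> f x) \<and>
     (\<forall>x y. \<forall>s\<in>{0..1}. f x powr (1 - s) * f y powr s \<le> f ((1 - s) * x + s * y))"

end

theory Submission imports Defs begin

text \<open>
  Cut the line at \<open>t\<close>. On each side of \<open>t\<close> the density, read outwards from \<open>t\<close>, is a log-concave
  function on a half-line with value \<open>f t\<close> at the origin. Let \<open>p, A, C\<close> be the mass, first and second
  moment of the right half about \<open>t\<close>, and \<open>q, B, D\<close> those of the left half. Then
  \<open>p + q = 1\<close>, \<open>\<mu> - t = A - B\<close> and \<open>E (X - t)\<^sup>2 = C + D\<close>, so the claim becomes
  \<open>2 (C + D) \<le> 1 / (f t)\<^sup>2 + 3 (A - B)\<^sup>2\<close>.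

  Only two inequalities are needed on each half-line, namely \<open>f t * A \<le> p\<^sup>2\<close> and \<open>p * C \<le> 2 * A\<^sup>2\<close>
  (lemma \<open>half_line_moments\<close>); both are equalities for an exponential density. Both come from one
  elementary fact (lemma \<open>submultiplicative_moment\<close>): if \<open>h 0 * h (x + y) \<le> h x * h y\<close>, then integrating
  over the quadrant along the lines \<open>x + y = s\<close> gives \<open>h 0 * (\<integral> s * h s ds) \<le> (\<integral> h)\<^sup>2\<close>. It is applied first to
  the density and then to its tail \<open>G x = \<integral> u\<ge>x. h u\<close>, which inherits the inequality and whose moments
  are \<open>G 0 = p\<close>, \<open>\<integral> G = A\<close>, \<open>2 * (\<integral> x * G x dx) = C\<close>.

  What remains is a polynomial inequality. Writing \<open>A = a * p\<^sup>2\<close> and \<open>B = b * q\<^sup>2\<close> with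
  \<open>0 \<le> a, b \<le> r = 1 / f t\<close>, it suffices that \<open>4 a\<^sup>2 p\<^sup>3 + 4 b\<^sup>2 q\<^sup>3 \<le> r\<^sup>2 + 3 (a p\<^sup>2 - b q\<^sup>2)\<^sup>2\<close>. The difference of
  the two sides is convex in \<open>a\<close> and in \<open>b\<close> separately, so only the corners of the square
  \<open>[0, r]\<^sup>2\<close> matter; at \<open>a = b = r\<close>, the two-sided exponential densities with peak at \<open>t\<close>, there is equality.
\<close>

section \<open>Log-concave functions\<close>

text \<open>
  The points \<open>u\<close> and \<open>x + v\<close> lie between \<open>v\<close> and \<open>x + u\<close> and have the same sum, so they are the convex
  combinations of \<open>v\<close> and \<open>x + u\<close> with weights \<open>(1 - s, s)\<close> and \<open>(s, 1 - s)\<close>. In the product of the two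
  log-concavity inequalities the exponents add up to one.
\<close>

lemma log_concave_exchange:
  assumes "log_concave f" "v \<le> u" "0 \<le> x"
  shows "f v * f (x + u) \<le> f u * f (x + v)"
proof (cases "x + u - v = 0")
  case True
  then have "x = 0" "v = u" using assms(2,3) by linarith+
  then show ?thesis by simp
next
  case False
  define d where "d = x + u - v"
  define s where "s = (u - v) / d"
  have d: "d > 0" using False assms d_def by linarith
  have nn: "\<And>x. 0 \<le> f x" using assms(1) by (auto simp: log_concave_def)
  have s: "s \<in> {0..1}" "1 - s \<in> {0..1}" using assms d unfolding s_def d_def by (auto simp: field_simps)
  have lc: "f a powr (1 - s) * f b powr s \<le> f ((1 - s) * a + s * b)" if "s \<in> {0..1}" for a b s
    using assms(1) that unfolding log_concave_def by blast
  have sd: "s * d = u - v" using d by (simp add: s_def)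
  have 1: "(1 - s) * v + s * (x + u) = u" 
    using sd unfolding d_def by (simp add: algebra_simps)
  have 2: "(1 - s) * (x + u) + s * v = x + v"
    using sd unfolding d_def by (simp add: algebra_simps)
  have p: "a powr (1 - s) * a powr s = a" if "0 \<le> a" for a :: real
    using that by (cases "a = 0") (simp_all flip: powr_add)
  have "f v * f (x + u) = (f v powr (1 - s) * f (x + u) powr s) * (f (x + u) powr (1 - s) * f v powr s)"
    using p[OF nn[of v]] p[OF nn[of "x + u"]] by (metis (no_types, lifting) mult.assoc mult.commute)
  also have "\<dots> \<le> f u * f (x + v)"
    using lc[OF s(1), of v "x + u"] lc[OF s(1), of "x + u" v] nn unfolding 1 2
    by (intro mult_mono) auto
  finally show ?thesis .
qed

lemma log_concave_affine:
  assumes "log_concave f" shows "log_concave (\<lambda>x. f (a + b * x))"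
proof -
  have e: "a + b * ((1 - s) * x + s * y) = (1 - s) * (a + b * x) + s * (a + b * y)" for s x y
    by (simp add: algebra_simps)
  show ?thesis using assms unfolding log_concave_def e by blast
qed

section \<open>Moments on a half-line\<close>

text \<open>
  The square of the integral is the integral of \<open>h x * h y\<close> over the quadrant. Substituting
  \<open>y = s - x\<close>, the integrand is at least \<open>c * h s\<close> on the segment \<open>0 \<le> x \<le> s\<close>, which has length \<open>s\<close>.
  With values in the extended nonnegative reals no integrability has to be assumed.
\<close>
lemma submultiplicative_moment:
  fixes h :: "real \<Rightarrow> ennreal"
  assumes [measurable]: "h \<in> borel_measurable borel"
    and sub: "\<And>x y. 0 \<le> x \<Longrightarrow> 0 \<le> y \<Longrightarrow> c * h (x + y) \<le> h x * h y"
  shows "c * (\<integral>\<^sup>+x\<in>{0..}. ennreal x * h x \<partial>lborel) \<le> (\<integral>\<^sup>+x\<in>{0..}. h x \<partial>lborel)\<^sup>2"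
proof -
  let ?I = "\<integral>\<^sup>+x\<in>{0..}. h x \<partial>lborel"
  have len: "c * (ennreal s * h s * indicator {0..} s)
      = (\<integral>\<^sup>+x. c * h s * indicator {0..s} x \<partial>lborel)" for s :: real
    by (cases "0 \<le> s") (simp add: nn_integral_cmult_indicator, simp add: mult_ac, simp)
  have "c * (\<integral>\<^sup>+x\<in>{0..}. ennreal x * h x \<partial>lborel)
      = (\<integral>\<^sup>+s. \<integral>\<^sup>+x. c * h s * indicator {0..s} x \<partial>lborel \<partial>lborel)"
    by (subst nn_integral_cmult[symmetric]) (simp_all add: len)
  also have "\<dots> \<le> (\<integral>\<^sup>+s. \<integral>\<^sup>+x. (h x * indicator {0..} x) * (h (s - x) * indicator {0..} (s - x)) \<partial>lborel \<partial>lborel)"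
  proof (intro nn_integral_mono)
    fix s x :: real
    show "c * h s * indicator {0..s} x \<le> (h x * indicator {0..} x) * (h (s - x) * indicator {0..} (s - x))"
      using sub[of x "s - x"] by (auto simp: indicator_def)
  qed
  also have "\<dots> = (\<integral>\<^sup>+x. \<integral>\<^sup>+s. (h x * indicator {0..} x) * (h (s - x) * indicator {0..} (s - x)) \<partial>lborel \<partial>lborel)"
    by (rule lborel_pair.Fubini') measurable
  also have "\<dots> = (\<integral>\<^sup>+x. (h x * indicator {0..} x) * ?I \<partial>lborel)"
  proof (intro nn_integral_cong)
    fix x :: real
    have "(\<integral>\<^sup>+s. h (s - x) * indicator {0..} (s - x) \<partial>lborel) = ?I"
      using nn_integral_real_affine[of "\<lambda>s. h s * indicator {0..} s" 1 "-x"]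
      by (simp add: algebra_simps)
    then show "(\<integral>\<^sup>+s. (h x * indicator {0..} x) * (h (s - x) * indicator {0..} (s - x)) \<partial>lborel)
      = (h x * indicator {0..} x) * ?I"
      by (subst nn_integral_cmult) auto
  qed
  also have "\<dots> = ?I\<^sup>2"
    by (simp add: nn_integral_multc power2_eq_square)
  finally show ?thesis .
qed

text \<open>
  Tonelli's theorem; it turns the moments of the tail of \<open>h\<close> into moments of \<open>h\<close> one degree higher.
\<close>
lemma tail_integral:
  fixes h w :: "real \<Rightarrow> ennreal"
  assumes [measurable]: "h \<in> borel_measurable borel" "w \<in> borel_measurable borel"
  shows "(\<integral>\<^sup>+x\<in>{0..}. w x * (\<integral>\<^sup>+u\<in>{x..}. h u \<partial>lborel) \<partial>lborel)
    = (\<integral>\<^sup>+u. (\<integral>\<^sup>+x\<in>{0..u}. w x \<partial>lborel) * h u \<partial>lborel)"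
proof -
  have "(\<integral>\<^sup>+x\<in>{0..}. w x * (\<integral>\<^sup>+u\<in>{x..}. h u \<partial>lborel) \<partial>lborel)
    = (\<integral>\<^sup>+x. \<integral>\<^sup>+u. w x * indicator {0..} x * (h u * indicator {x..} u) \<partial>lborel \<partial>lborel)"
    by (intro nn_integral_cong) (subst nn_integral_cmult, simp_all add: mult_ac)
  also have "\<dots> = (\<integral>\<^sup>+x. \<integral>\<^sup>+u. w x * indicator {0..u} x * h u \<partial>lborel \<partial>lborel)"
    by (intro nn_integral_cong) (auto simp: indicator_def)
  also have "\<dots> = (\<integral>\<^sup>+u. \<integral>\<^sup>+x. w x * indicator {0..u} x * h u \<partial>lborel \<partial>lborel)"
    by (rule lborel_pair.Fubini') (simp add: indicator_def, measurable)
  also have "\<dots> = (\<integral>\<^sup>+u. (\<integral>\<^sup>+x\<in>{0..u}. w x \<partial>lborel) * h u \<partial>lborel)"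
    by (intro nn_integral_cong) (simp add: nn_integral_multc)
  finally show ?thesis .
qed

text \<open>
  Write \<open>G 0 = A + G y\<close> and \<open>G x = B + G (x + y)\<close>, splitting off the parts \<open>A\<close>, \<open>B\<close> with \<open>v < y\<close>. The
  product \<open>G y * G (x + y)\<close> occurs on both sides, so only \<open>A * G (x + y) \<le> B * G y\<close> is at stake, and there
  the two integration variables satisfy \<open>v < y \<le> u\<close>: the exchange inequality applies pointwise.
\<close>
lemma tail_submultiplicative:
  fixes h :: "real \<Rightarrow> ennreal"
  assumes [measurable]: "h \<in> borel_measurable borel"
    and exch: "\<And>u v x. 0 \<le> v \<Longrightarrow> v \<le> u \<Longrightarrow> 0 \<le> x \<Longrightarrow> h v * h (x + u) \<le> h u * h (x + v)"
    and "0 \<le> x" "0 \<le> y"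
  defines "G \<equiv> \<lambda>x. \<integral>\<^sup>+u\<in>{x..}. h u \<partial>lborel"
  shows "G 0 * G (x + y) \<le> G x * G y"
proof -
  define A where "A = (\<integral>\<^sup>+v\<in>{0..<y}. h v \<partial>lborel)"
  define B where "B = (\<integral>\<^sup>+v\<in>{0..<y}. h (x + v) \<partial>lborel)"
  have shift: "G (x + z) = (\<integral>\<^sup>+u\<in>{z..}. h (x + u) \<partial>lborel)" for z
    unfolding G_def using nn_integral_real_affine[of "\<lambda>u. h u * indicator {x + z..} u" 1 x]
    by (simp add: indicator_def)
  have split: "(\<integral>\<^sup>+v\<in>{0..}. k v \<partial>lborel) = (\<integral>\<^sup>+v\<in>{0..<y}. k v \<partial>lborel) + (\<integral>\<^sup>+v\<in>{y..}. k v \<partial>lborel)"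
    if [measurable]: "k \<in> borel_measurable borel" for k :: "real \<Rightarrow> ennreal"
    using \<open>0 \<le> y\<close> by (subst nn_integral_add[symmetric])
      (auto intro!: nn_integral_cong simp: indicator_def)
  have G0: "G 0 = A + G y"
    unfolding A_def G_def by (rule split) measurable
  have Gx: "G x = B + G (x + y)"
    using shift[of 0] unfolding B_def shift[of y] by (simp add: split)
  have "A * G (x + y) = (\<integral>\<^sup>+u. \<integral>\<^sup>+v. (h v * indicator {0..<y} v) * (h (x + u) * indicator {y..} u) \<partial>lborel \<partial>lborel)"
    unfolding A_def shift by (simp add: nn_integral_cmult nn_integral_multc)
  also have "\<dots> \<le> (\<integral>\<^sup>+u. \<integral>\<^sup>+v. (h (x + v) * indicator {0..<y} v) * (h u * indicator {y..} u) \<partial>lborel \<partial>lborel)"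
  proof (intro nn_integral_mono)
    fix u v :: real
    show "(h v * indicator {0..<y} v) * (h (x + u) * indicator {y..} u)
      \<le> (h (x + v) * indicator {0..<y} v) * (h u * indicator {y..} u)"
      using exch[of v u x] \<open>0 \<le> x\<close> by (auto simp: indicator_def mult_ac)
  qed
  also have "\<dots> = B * G y"
    unfolding B_def G_def by (simp add: nn_integral_cmult nn_integral_multc)
  finally have "A * G (x + y) \<le> B * G y" .
  then show ?thesis
    unfolding G0 Gx by (simp add: distrib_left distrib_right mult.commute add_mono)
qed

text \<open>
  The third claim covers the case \<open>p = 0\<close>, in which the second inequality says nothing about \<open>C\<close>; it
  occurs, for instance, when \<open>0\<close> is the right end of the support of \<open>g\<close>.
\<close>
lemma half_line_moments:
  fixes g :: "real \<Rightarrow> real"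
  assumes lc: "log_concave g" and [measurable]: "g \<in> borel_measurable borel"
  defines "p \<equiv> \<integral>\<^sup>+x\<in>{0..}. ennreal (g x) \<partial>lborel"
    and "A \<equiv> \<integral>\<^sup>+x\<in>{0..}. ennreal x * ennreal (g x) \<partial>lborel"
    and "C \<equiv> \<integral>\<^sup>+x\<in>{0..}. ennreal (x\<^sup>2) * ennreal (g x) \<partial>lborel"
  shows "ennreal (g 0) * A \<le> p\<^sup>2" "p * C \<le> 2 * A\<^sup>2" "p = 0 \<Longrightarrow> C = 0"
proof -
  have nn: "\<And>x. 0 \<le> g x" using lc by (auto simp: log_concave_def)
  define h where "h = (\<lambda>x. ennreal (g x))"
  define G where "G = (\<lambda>x. \<integral>\<^sup>+u\<in>{x..}. h u \<partial>lborel)"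
  have [measurable]: "h \<in> borel_measurable borel" unfolding h_def by measurable
  have exch: "h v * h (x + u) \<le> h u * h (x + v)" if "v \<le> u" "0 \<le> x" for u v x
    using log_concave_exchange[OF lc that] nn by (simp add: h_def ennreal_mult[symmetric])
  show "ennreal (g 0) * A \<le> p\<^sup>2"
    unfolding A_def p_def
    by (rule submultiplicative_moment) (use exch[of 0] in \<open>auto simp: h_def add.commute\<close>)
  have [measurable]: "G \<in> borel_measurable borel"
    unfolding G_def by (simp add: indicator_def) measurable
  have GA: "(\<integral>\<^sup>+x\<in>{0..}. G x \<partial>lborel) = A"
  proof -
    have "(\<integral>\<^sup>+x\<in>{0..}. G x \<partial>lborel) = (\<integral>\<^sup>+x\<in>{0..}. 1 * (\<integral>\<^sup>+u\<in>{x..}. h u \<partial>lborel) \<partial>lborel)"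
      by (simp add: G_def)
    also have "\<dots> = (\<integral>\<^sup>+u. (\<integral>\<^sup>+x\<in>{0..u}. 1 \<partial>lborel) * h u \<partial>lborel)"
      by (rule tail_integral) measurable
    also have "\<dots> = A" unfolding A_def h_def
    proof (intro nn_integral_cong)
      fix u :: real
      show "(\<integral>\<^sup>+x\<in>{0..u}. 1 \<partial>lborel) * ennreal (g u) = ennreal u * ennreal (g u) * indicator {0..} u"
        by (cases "0 \<le> u") simp_all
    qed
    finally show ?thesis .
  qed
  have GC: "2 * (\<integral>\<^sup>+x\<in>{0..}. ennreal x * G x \<partial>lborel) = C"
  proof -
    have sq: "2 * (\<integral>\<^sup>+x\<in>{0..u}. ennreal x \<partial>lborel) = ennreal (u\<^sup>2) * indicator {0..} u" for u :: real
    proof (cases "0 \<le> u")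
      case True
      have "(\<integral>\<^sup>+x\<in>{0..u}. ennreal x \<partial>lborel) = ennreal (u\<^sup>2 / 2 - 0\<^sup>2 / 2)"
        by (rule nn_integral_FTC_Icc) (use True in \<open>auto intro!: derivative_eq_intros\<close>)
      then show ?thesis using True by (simp add: ennreal_mult[symmetric] flip: ennreal_numeral)
    qed simp
    have "(\<integral>\<^sup>+x\<in>{0..}. ennreal x * G x \<partial>lborel) = (\<integral>\<^sup>+u. (\<integral>\<^sup>+x\<in>{0..u}. ennreal x \<partial>lborel) * h u \<partial>lborel)"
      unfolding G_def by (rule tail_integral) measurable
    then have "2 * (\<integral>\<^sup>+x\<in>{0..}. ennreal x * G x \<partial>lborel) = (\<integral>\<^sup>+u. 2 * ((\<integral>\<^sup>+x\<in>{0..u}. ennreal x \<partial>lborel) * h u) \<partial>lborel)"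
      by (subst nn_integral_cmult) (simp_all add: indicator_def, measurable)
    also have "\<dots> = C"
      unfolding C_def by (intro nn_integral_cong) (simp only: mult.assoc[symmetric] sq, simp only: h_def mult_ac)
    finally show ?thesis .
  qed
  \<comment> \<open>The second inequality is the first one for the tail \<open>G\<close> in place of the density.\<close>
  have "G 0 * (\<integral>\<^sup>+x\<in>{0..}. ennreal x * G x \<partial>lborel) \<le> (\<integral>\<^sup>+x\<in>{0..}. G x \<partial>lborel)\<^sup>2"
    by (rule submultiplicative_moment, measurable)
      (auto simp: G_def intro!: tail_submultiplicative exch)
  then have "2 * (G 0 * (\<integral>\<^sup>+x\<in>{0..}. ennreal x * G x \<partial>lborel)) \<le> 2 * A\<^sup>2"
    unfolding GA by (intro mult_left_mono) auto
  moreover have "G 0 = p" by (simp add: G_def p_def h_def)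
  ultimately show "p * C \<le> 2 * A\<^sup>2"
    unfolding GC[symmetric] by (simp add: mult_ac)
  show "C = 0" if "p = 0"
  proof -
    have "AE x in lborel. ennreal (g x) * indicator {0..} x = 0"
      using that unfolding p_def by (subst (asm) nn_integral_0_iff_AE) auto
    then show ?thesis unfolding C_def
      by (subst nn_integral_0_iff_AE) (auto elim!: eventually_mono)
  qed
qed

section \<open>The polynomial inequality\<close>

lemma quartic_bound_unit_interval:
  fixes q :: real assumes "0 \<le> q" "q \<le> 1" shows "4 * q^3 \<le> 1 + 3 * q^4"
proof -
  have "1 + 3 * q^4 - 4 * q^3 = (q - 1)\<^sup>2 * (3 * q\<^sup>2 + 2 * q + 1)"
    by algebra
  moreover have "0 \<le> (q - 1)\<^sup>2 * (3 * q\<^sup>2 + 2 * q + 1)" using assms by auto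
  ultimately show ?thesis by linarith
qed

text \<open>
  As a function of \<open>a\<close>, left side minus right side is a quadratic with leading coefficient
  \<open>4 p\<^sup>3 - 3 p\<^sup>4 \<ge> 0\<close>, and likewise in \<open>b\<close>. Hence its maximum over the square \<open>[0, r]\<^sup>2\<close> is attained at a corner. At
  \<open>(r, r)\<close> it vanishes because \<open>p + q = 1\<close>; at \<open>(r, 0)\<close> and \<open>(0, r)\<close> the claim is the quartic bound above.
\<close>
lemma convex_corner_bound:
  fixes p q a b r :: real
  assumes "0 \<le> p" "0 \<le> q" "p + q = 1" "0 \<le> a" "a \<le> r" "0 \<le> b" "b \<le> r"
  shows "4 * a\<^sup>2 * p^3 + 4 * b\<^sup>2 * q^3 \<le> r\<^sup>2 + 3 * (a * p\<^sup>2 - b * q\<^sup>2)\<^sup>2"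
proof -
  have r: "0 \<le> r" using assms by linarith
  \<comment> \<open>A convex quadratic that vanishes at \<open>0\<close> lies below its chord over \<open>[0, r]\<close>. The facts \<open>edge\<close>,
    \<open>corner\<close> and \<open>1\<close> below supply the bounds at the end points.\<close>
  have chord: "k * a\<^sup>2 + l * a \<le> m" if "0 \<le> k" "0 \<le> m" "k * r\<^sup>2 + l * r \<le> m" "0 \<le> a" "a \<le> r" for k l m a :: real
  proof (cases "r = 0")
    case False
    then have r: "r > 0" using \<open>0 \<le> r\<close> by simp
    have "r * (k * a\<^sup>2 + l * a) \<le> a * (k * r\<^sup>2 + l * r)"
      using mult_left_mono[OF \<open>a \<le> r\<close>, of "k * a * r"] that r by (simp add: power2_eq_square algebra_simps)
    also have "\<dots> \<le> a * m" using that by (intro mult_left_mono)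
    also have "\<dots> \<le> r * m" using that by (intro mult_right_mono)
    finally show ?thesis using r by simp
  qed (use that in auto)
  have k: "0 \<le> 4 * x^3 - 3 * x^4" if "0 \<le> x" "x \<le> 1" for x :: real
  proof -
    have "4 * x^3 - 3 * x^4 = x^3 * (4 - 3 * x)" by algebra
    then show ?thesis using that by simp
  qed
  have pq: "p \<le> 1" "q \<le> 1" using assms by auto
  have edge: "(4 * x^3 - 3 * x^4) * b\<^sup>2 \<le> r\<^sup>2" if "0 \<le> x" "x \<le> 1" "0 \<le> b" "b \<le> r" for x b :: real
  proof -
    have "(4 * x^3 - 3 * x^4) * b\<^sup>2 \<le> 1 * r\<^sup>2"
      using quartic_bound_unit_interval[OF that(1,2)] k[OF that(1,2)] that r by (intro mult_mono power_mono) auto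
    then show ?thesis by simp
  qed
  have corner: "4 * r\<^sup>2 * p^3 + 4 * r\<^sup>2 * q^3 = r\<^sup>2 + 3 * (r * p\<^sup>2 - r * q\<^sup>2)\<^sup>2"
  proof -
    have q: "q = 1 - p" using assms by linarith
    show ?thesis unfolding q by algebra
  qed
  \<comment> \<open>The claim on the side \<open>a = r\<close> of the square, by convexity in \<open>b\<close>. The next step extends it to all \<open>a\<close>.\<close>
  have 1: "(4 * q^3 - 3 * q^4) * b\<^sup>2 + (6 * r * p\<^sup>2 * q\<^sup>2) * b \<le> r\<^sup>2 - (4 * p^3 - 3 * p^4) * r\<^sup>2"
  proof (rule chord)
    show "(4 * q^3 - 3 * q^4) * r\<^sup>2 + (6 * r * p\<^sup>2 * q\<^sup>2) * r \<le> r\<^sup>2 - (4 * p^3 - 3 * p^4) * r\<^sup>2"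
      using corner by (simp add: algebra_simps power2_eq_square power3_eq_cube power4_eq_xxxx)
  qed (use k[of q] edge[of p r] assms pq r in auto)
  have "(4 * p^3 - 3 * p^4) * a\<^sup>2 + (6 * p\<^sup>2 * q\<^sup>2 * b) * a \<le> r\<^sup>2 - (4 * q^3 - 3 * q^4) * b\<^sup>2"
    by (rule chord) (use k[of p] edge[of q b] assms pq r 1 in \<open>auto simp: mult_ac\<close>)
  then show ?thesis
    by (simp add: algebra_simps power2_eq_square power3_eq_cube power4_eq_xxxx)
qed

text \<open>
  The parameters \<open>a = A / p\<^sup>2\<close> and \<open>b = B / q\<^sup>2\<close> range over \<open>[0, 1 / c]\<close>, and the bounds on \<open>C\<close> and \<open>D\<close>
  become \<open>C \<le> 2 a\<^sup>2 p\<^sup>3\<close> and \<open>D \<le> 2 b\<^sup>2 q\<^sup>3\<close>.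
\<close>
lemma second_moment_bound:
  fixes c p q A B C D :: real
  assumes c: "0 < c" and pq: "0 \<le> p" "0 \<le> q" "p + q = 1" and AB: "0 \<le> A" "0 \<le> B"
    and 1: "c * A \<le> p\<^sup>2" "c * B \<le> q\<^sup>2"
    and 2: "p * C \<le> 2 * A\<^sup>2" "q * D \<le> 2 * B\<^sup>2"
    and 3: "p = 0 \<Longrightarrow> C = 0" "q = 0 \<Longrightarrow> D = 0"
  shows "2 * (C + D) \<le> 1 / c\<^sup>2 + 3 * (A - B)\<^sup>2"
proof -
  have *: "\<exists>a. 0 \<le> a \<and> a \<le> 1 / c \<and> A = a * p\<^sup>2 \<and> C \<le> 2 * a\<^sup>2 * p^3"
    if "0 \<le> p" "0 \<le> A" "c * A \<le> p\<^sup>2" "p * C \<le> 2 * A\<^sup>2" "p = 0 \<Longrightarrow> C = 0" for p A C :: real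
  proof (cases "p = 0")
    case True
    then have "A = 0" using that c by (simp add: mult_le_0_iff)
    then show ?thesis using that True c by (intro exI[of _ 0]) auto
  next
    case False
    then have p: "0 < p" using that by simp
    have "p * C \<le> p * (2 * (A / p\<^sup>2)\<^sup>2 * p^3)"
      using that(4) p by (simp add: field_simps power2_eq_square power3_eq_cube)
    then show ?thesis using that p c 
      by (intro exI[of _ "A / p\<^sup>2"]) (auto simp: field_simps)
  qed
  from *[of p A C] assms obtain a where a: "0 \<le> a" "a \<le> 1 / c" "A = a * p\<^sup>2" "C \<le> 2 * a\<^sup>2 * p^3" by blast
  from *[of q B D] assms obtain b where b: "0 \<le> b" "b \<le> 1 / c" "B = b * q\<^sup>2" "D \<le> 2 * b\<^sup>2 * q^3" by blast
  show ?thesis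
    using convex_corner_bound[OF pq a(1,2) b(1,2)] a(4) b(4) unfolding a(3) b(3) by (simp add: power_divide)
qed


section \<open>The variance bound\<close>

text \<open>
  Since \<^const>\<open>ennreal\<close> sends negative reals to \<open>0\<close>, the integral \<open>A\<close> only sees the positive part of \<open>Y\<close>.
\<close>
lemma (in prob_space) positive_part_moments:
  fixes Y :: "'a \<Rightarrow> real" and g :: "real \<Rightarrow> real"
  assumes Y: "distributed M lborel Y (\<lambda>x. ennreal (g x))" and lc: "log_concave g"
  defines "p \<equiv> \<integral>\<^sup>+\<omega>. indicator {0..} (Y \<omega>) \<partial>M"
    and "A \<equiv> \<integral>\<^sup>+\<omega>. ennreal (Y \<omega>) \<partial>M"
    and "C \<equiv> \<integral>\<^sup>+\<omega>. ennreal ((Y \<omega>)\<^sup>2) * indicator {0..} (Y \<omega>) \<partial>M"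
  shows "ennreal (g 0) * A \<le> p\<^sup>2" "p * C \<le> 2 * A\<^sup>2" "p = 0 \<Longrightarrow> C = 0"
proof -
  have [measurable]: "(\<lambda>x. ennreal (g x)) \<in> borel_measurable borel"
    using Y by (simp add: distributed_def)
  have "(\<lambda>x. enn2real (ennreal (g x))) \<in> borel_measurable borel" by measurable
  moreover have "\<And>x. 0 \<le> g x" using lc by (auto simp: log_concave_def)
  ultimately have g: "g \<in> borel_measurable borel" by simp
  note law = distributed_nn_integral[OF Y]
  have p: "p = (\<integral>\<^sup>+x\<in>{0..}. ennreal (g x) \<partial>lborel)"
    unfolding p_def by (subst law[symmetric]) auto
  have "A = (\<integral>\<^sup>+x. ennreal (g x) * ennreal x \<partial>lborel)"
    unfolding A_def by (subst law[symmetric]) auto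
  also have "\<dots> = (\<integral>\<^sup>+x\<in>{0..}. ennreal x * ennreal (g x) \<partial>lborel)"
    by (intro nn_integral_cong) (auto simp: indicator_def mult.commute ennreal_neg)
  finally have A: "A = (\<integral>\<^sup>+x\<in>{0..}. ennreal x * ennreal (g x) \<partial>lborel)" .
  have C: "C = (\<integral>\<^sup>+x\<in>{0..}. ennreal (x\<^sup>2) * ennreal (g x) \<partial>lborel)"
    unfolding C_def using law[of "\<lambda>x. ennreal (x\<^sup>2) * indicator {0..} x"] by (simp add: mult_ac)
  show "ennreal (g 0) * A \<le> p\<^sup>2" "p * C \<le> 2 * A\<^sup>2" "p = 0 \<Longrightarrow> C = 0"
    using half_line_moments[OF lc g] unfolding p A C by auto
qed

text \<open>
  The half-line bounds are applied to \<open>X - t\<close> and to \<open>t - X\<close>. The event \<open>X = t\<close> is counted in both halves,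
  but it is a null event because \<open>X\<close> has a density.
\<close>
lemma (in prob_space) second_moment_about_point:
  fixes X :: "'a \<Rightarrow> real" and f :: "real \<Rightarrow> real"
  assumes X: "distributed M lborel X (\<lambda>x. ennreal (f x))" and lc: "log_concave f"
    and ft: "0 < f t"
    and int: "integrable M X" and int2: "integrable M (\<lambda>\<omega>. (X \<omega> - t)\<^sup>2)"
  shows "2 * expectation (\<lambda>\<omega>. (X \<omega> - t)\<^sup>2) \<le> 1 / (f t)\<^sup>2 + 3 * (expectation X - t)\<^sup>2"
proof -
  have X_meas[measurable]: "X \<in> borel_measurable M" using X by (simp add: distributed_def)
  have div1: "x / 1 = x" for x :: ennreal by (simp add: divide_ennreal_def)
  have R: "distributed M lborel (\<lambda>\<omega>. X \<omega> - t) (\<lambda>x. ennreal (f (t + 1 * x)))"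
    using distributed_affine[OF X, of 1 "-t"] by (simp add: div1 add.commute)
  have L: "distributed M lborel (\<lambda>\<omega>. t - X \<omega>) (\<lambda>x. ennreal (f (t + (-1) * x)))"
    using distributed_affine[OF X, of "-1" t] by (simp add: div1)
  note momR = positive_part_moments[OF R log_concave_affine[OF lc]]
  note momL = positive_part_moments[OF L log_concave_affine[OF lc]]
  define P where "P = (\<integral>\<^sup>+\<omega>. indicator {0..} (X \<omega> - t) \<partial>M)"
  define Q where "Q = (\<integral>\<^sup>+\<omega>. indicator {0..} (t - X \<omega>) \<partial>M)"
  define A where "A = (\<integral>\<^sup>+\<omega>. ennreal (X \<omega> - t) \<partial>M)"
  define B where "B = (\<integral>\<^sup>+\<omega>. ennreal (t - X \<omega>) \<partial>M)"
  define C where "C = (\<integral>\<^sup>+\<omega>. ennreal ((X \<omega> - t)\<^sup>2) * indicator {0..} (X \<omega> - t) \<partial>M)"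
  define D where "D = (\<integral>\<^sup>+\<omega>. ennreal ((t - X \<omega>)\<^sup>2) * indicator {0..} (t - X \<omega>) \<partial>M)"
  have "AE \<omega> in M. X \<omega> \<noteq> t"
    using AE_lborel_singleton[of t] by (subst distributed_AE2[OF X]) auto
  then have "AE \<omega> in M. indicator {0..} (X \<omega> - t) + indicator {0..} (t - X \<omega>) = (1 :: ennreal)"
    by (rule eventually_mono) (auto simp: indicator_def)
  then have "(\<integral>\<^sup>+\<omega>. indicator {0..} (X \<omega> - t) + indicator {0..} (t - X \<omega>) \<partial>M) = (\<integral>\<^sup>+\<omega>. 1 \<partial>M)"
    by (rule nn_integral_cong_AE)
  then have PQ: "P + Q = 1"
    unfolding P_def Q_def by (subst (asm) nn_integral_add) (simp_all add: emeasure_space_1)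
  have "C + D = (\<integral>\<^sup>+\<omega>. ennreal ((X \<omega> - t)\<^sup>2) \<partial>M)"
    unfolding C_def D_def
    by (subst nn_integral_add[symmetric])
       (auto intro!: nn_integral_cong simp: indicator_def power2_commute)
  also have "\<dots> = ennreal (expectation (\<lambda>\<omega>. (X \<omega> - t)\<^sup>2))"
    by (rule nn_integral_eq_integral[OF int2]) auto
  finally have CD: "C + D = ennreal (expectation (\<lambda>\<omega>. (X \<omega> - t)\<^sup>2))" .
  have intY: "integrable M (\<lambda>\<omega>. X \<omega> - t)" using int by simp
  then have fin: "A < \<infinity>" "B < \<infinity>"
    unfolding A_def B_def by (auto simp: real_integrable_def less_top)
  have AB: "expectation X - t = enn2real A - enn2real B"
    using real_lebesgue_integral_def[OF intY] int unfolding A_def B_def by (simp add: prob_space)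
  have "P < \<infinity>" "Q < \<infinity>" using PQ by (auto simp: less_top[symmetric])
  then obtain p q where pq: "P = ennreal p" "Q = ennreal q" "0 \<le> p" "0 \<le> q"
    by (metis ennreal_cases infinity_ennreal_def less_irrefl)
  have "C < \<infinity>" "D < \<infinity>" using CD by (auto simp: less_top[symmetric])
  then obtain c d where cd: "C = ennreal c" "D = ennreal d" "0 \<le> c" "0 \<le> d"
    by (metis ennreal_cases infinity_ennreal_def less_irrefl)
  obtain a b where ab: "A = ennreal a" "B = ennreal b" "0 \<le> a" "0 \<le> b"
    using fin by (metis ennreal_cases infinity_ennreal_def less_irrefl)
  note transfer = ennreal_mult[symmetric] ennreal_power ennreal_numeral[symmetric] ennreal_plus[symmetric]
  have sum1: "p + q = 1" using PQ pq by (simp add: ennreal_plus[symmetric] del: ennreal_plus)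
  have right: "f t * a \<le> p\<^sup>2" "p * c \<le> 2 * a\<^sup>2" "p = 0 \<Longrightarrow> c = 0"
    using momR pq cd ab ft unfolding P_def[symmetric] A_def[symmetric] C_def[symmetric]
    by (simp_all add: transfer del: ennreal_plus ennreal_numeral)
  have left: "f t * b \<le> q\<^sup>2" "q * d \<le> 2 * b\<^sup>2" "q = 0 \<Longrightarrow> d = 0"
    using momL pq cd ab ft unfolding Q_def[symmetric] B_def[symmetric] D_def[symmetric]
    by (simp_all add: transfer del: ennreal_plus ennreal_numeral)
  have "2 * (c + d) \<le> 1 / (f t)\<^sup>2 + 3 * (a - b)\<^sup>2"
    by (rule second_moment_bound[OF ft pq(3,4) sum1 ab(3,4) right(1) left(1) right(2) left(2)])
       (fact right(3) left(3))+
  moreover have "expectation (\<lambda>\<omega>. (X \<omega> - t)\<^sup>2) = c + d"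
    using CD cd by (simp add: ennreal_plus[symmetric] del: ennreal_plus)
  moreover have "expectation X - t = a - b" using AB ab by simp
  ultimately show ?thesis by simp
qed

theorem theorem1p1:
  fixes M :: "'a measure" and X :: "'a \<Rightarrow> real" and f :: "real \<Rightarrow> real" and \<mu> t :: real
  assumes "prob_space M"
    and "distributed M lborel X (\<lambda>x. ennreal (f x))"
    and "log_concave f"
    and "\<mu> = prob_space.expectation M X"
  shows "ereal (2 * prob_space.variance M X) \<le> 1 / ereal ((f t)\<^sup>2) + ereal ((\<mu> - t)\<^sup>2)"
proof -
  interpret prob_space M by fact
  have [measurable]: "X \<in> borel_measurable M" using assms(2) by (simp add: distributed_def)
  have "0 \<le> f t" using assms(3) by (auto simp: log_concave_def)
  then consider "f t = 0" | "0 < f t" "\<not> integrable M (\<lambda>\<omega>. (X \<omega> - \<mu>)\<^sup>2)"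
    | "0 < f t" "integrable M (\<lambda>\<omega>. (X \<omega> - \<mu>)\<^sup>2)" by linarith
  moreover have rhs: "1 / ereal ((f t)\<^sup>2) + ereal ((\<mu> - t)\<^sup>2) = ereal (1 / (f t)\<^sup>2 + (\<mu> - t)\<^sup>2)"
    if "0 < f t"
    using that by (simp add: one_ereal_def del: ereal_eq_1)
  ultimately show ?thesis
  proof cases
    \<comment> \<open>The right-hand side is infinite, as \<open>1 / 0 = \<infinity>\<close> in the extended reals.\<close>
    case 1
    then show ?thesis by (simp add: divide_ereal_def)
  next
    case 2
    \<comment> \<open>The Bochner integral of a function that is not integrable is \<open>0\<close> by definition.\<close>
    have "variance X = 0"
      using 2(2) unfolding assms(4) by (rule not_integrable_integral_eq)
    then have "2 * variance X \<le> 1 / (f t)\<^sup>2 + (\<mu> - t)\<^sup>2" by simp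
    then show ?thesis unfolding rhs[OF 2(1)] by simp
  next
    case 3
    have "integrable M (\<lambda>\<omega>. X \<omega> - \<mu>)"
      by (rule square_integrable_imp_integrable[OF _ 3(2)]) measurable
    then have "integrable M (\<lambda>\<omega>. (X \<omega> - \<mu>) + \<mu>)" by (intro Bochner_Integration.integrable_add) auto
    then have int: "integrable M X" by simp
    have shift: "(X \<omega> - t)\<^sup>2 = (X \<omega> - \<mu>)\<^sup>2 + (2 * (\<mu> - t) * (X \<omega> - \<mu>) + (\<mu> - t)\<^sup>2)" for \<omega>
      by (simp add: power2_eq_square algebra_simps)
    have int2: "integrable M (\<lambda>\<omega>. (X \<omega> - t)\<^sup>2)"
      unfolding shift using 3(2) int by (intro Bochner_Integration.integrable_add) auto
    have "expectation (\<lambda>\<omega>. (X \<omega> - t)\<^sup>2) = variance X + (\<mu> - t)\<^sup>2"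
      unfolding shift using 3(2) int by (simp add: assms(4) prob_space)
    then have "2 * variance X \<le> 1 / (f t)\<^sup>2 + (\<mu> - t)\<^sup>2"
      using second_moment_about_point[OF assms(2,3) 3(1) int int2] by (simp add: assms(4))
    then show ?thesis unfolding rhs[OF 3(1)] by simp
  qed
qed

end
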